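(* Any isometric action of Thompson's group $V$ on a Gromov-hyperbolic space either fixes a point at infinity or has bounded orbits.
   Context: Thompson's group $V$: a dyadic interval is an interval $\left[\frac{j}{2^m},\frac{j+1}{2^m}\right]\subset[0,1]$; a dyadic decomposition of $[0,1]$ is a finite collection of dyadic intervals covering $[0,1]$, any two of which share at most one point. Identify the Cantor set $\mathfrak{C}$ with $\{0,1\}^{\mathbb{N}}$, a dyadic interval corresponding to the set (cylinder) of sequences with a given finite prefix. Given two dyadic decompositions $\mathfrak{A},\mathfrak{B}$ and a bijection $\sigma:\mathfrak{A}\to\mathfrak{B}$, one gets a homeomorphism of $\mathfrak{C}$ sending each piece $A\in\mathfrak A$ to $\sigma(A)$ by the canonical orientation-preserving affine map (prefix replacement). $V$ is the group of all homeomorphisms of $\mathfrak{C}$ obtained in this way. A metric space $X$ is $\delta$-hyperbolic ($\delta\ge 0$) if $(x,z)_w \geq \min((x,y)_w,(y,z)_w)-\delta$ for all $x,y,z,w\in X$, where $(x,y)_z=\frac12(d(z,x)+d(z,y)-d(x,y))$; it is Gromov-hyperbolic if it is $\delta$-hyperbolic for some $\delta\ge0$. The points at infinity of $X$ are the points of its Gromov boundary: equivalence classes of sequences $(x_i)$ with $(x_i,x_j)_{x_0}\to+\infty$ as $i,j\to+\infty$ (for a basepoint $x_0$), two sequences $(y_i),(z_i)$ being equivalent if $(y_i,z_i)_{x_0}\to+\infty$. *)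

theory Defs
  imports "HOL-Analysis.Analysis" "HOL-Algebra.Group_Action" "HOL-Library.Stream"
    "HOL-Library.Sublist"
begin

section \<open>Thompson's group V\<close>

text \<open>
  The Cantor set is the type \<^typ>\<open>bool stream\<close> of infinite binary sequences. A dyadic interval
  is coded by its address, the finite word \<open>w\<close> of the first binary digits of its
  points: the address \<open>w\<close> of length \<open>m\<close>, read as a binary number \<open>j\<close> with the most significant digit
  first, stands for \<open>[j/2^m, (j+1)/2^m]\<close>. The corresponding cylinder consists of the
  sequences \<^term>\<open>w @- x\<close>.
\<close>

definition dyadic_interval :: "bool list \<Rightarrow> real set" where
  "dyadic_interval w =
     (let j = horner_sum of_bool 2 (rev w) :: real; m = length w
      in {j / 2 ^ m .. (j + 1) / 2 ^ m})"

definition dyadic_decomposition :: "bool list set \<Rightarrow> bool" where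
  "dyadic_decomposition A \<longleftrightarrow>
     finite A \<and> (\<Union>w\<in>A. dyadic_interval w) = {0..1} \<and>
     (\<forall>u\<in>A. \<forall>v\<in>A. u \<noteq> v \<longrightarrow>
        (\<forall>s\<in>dyadic_interval u \<inter> dyadic_interval v.
         \<forall>t\<in>dyadic_interval u \<inter> dyadic_interval v. s = t))"

definition prefix_replacement ::
  "bool list set \<Rightarrow> bool list set \<Rightarrow> (bool list \<Rightarrow> bool list) \<Rightarrow> (bool stream \<Rightarrow> bool stream) \<Rightarrow> bool" where
  "prefix_replacement A B \<sigma> f \<longleftrightarrow>
     dyadic_decomposition A \<and> dyadic_decomposition B \<and> bij_betw \<sigma> A B \<and>
     (\<forall>w\<in>A. \<forall>x. f (w @- x) = \<sigma> w @- x)"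

definition thompson_V :: "(bool stream \<Rightarrow> bool stream) monoid" where
  "thompson_V = \<lparr>carrier = {f. \<exists>A B \<sigma>. prefix_replacement A B \<sigma> f}, mult = (\<circ>), one = id\<rparr>"


section \<open>Gromov-hyperbolic spaces and their boundary\<close>

definition gromov_product :: "'a::metric_space \<Rightarrow> 'a \<Rightarrow> 'a \<Rightarrow> real" where
  "gromov_product z x y = (dist z x + dist z y - dist x y) / 2"

definition delta_hyperbolic :: "real \<Rightarrow> 'a::metric_space itself \<Rightarrow> bool" where
  "delta_hyperbolic \<delta> _ \<longleftrightarrow>
     (\<forall>x y z w :: 'a. gromov_product w x z \<ge> min (gromov_product w x y) (gromov_product w y z) - \<delta>)"

definition gromov_hyperbolic :: "'a::metric_space itself \<Rightarrow> bool" where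
  "gromov_hyperbolic T \<longleftrightarrow> (\<exists>\<delta>\<ge>0. delta_hyperbolic \<delta> T)"

text \<open>In the next three definitions \<open>p\<close> is the basepoint.\<close>

definition converges_at_infinity :: "'a::metric_space \<Rightarrow> (nat \<Rightarrow> 'a) \<Rightarrow> bool" where
  "converges_at_infinity p x \<longleftrightarrow>
     filterlim (\<lambda>(i, j). gromov_product p (x i) (x j)) at_top (sequentially \<times>\<^sub>F sequentially)"

definition infinity_rel :: "'a::metric_space \<Rightarrow> ((nat \<Rightarrow> 'a) \<times> (nat \<Rightarrow> 'a)) set" where
  "infinity_rel p =
     {(y, z). converges_at_infinity p y \<and> converges_at_infinity p z \<and>
              filterlim (\<lambda>i. gromov_product p (y i) (z i)) at_top sequentially}"

definition gromov_boundary :: "'a::metric_space \<Rightarrow> (nat \<Rightarrow> 'a) set set" where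
  "gromov_boundary p = {x. converges_at_infinity p x} // infinity_rel p"

text \<open>The map induced on boundary points, which are classes of sequences, by a self-map of the space.\<close>

definition boundary_map :: "('a \<Rightarrow> 'a) \<Rightarrow> (nat \<Rightarrow> 'a) set \<Rightarrow> (nat \<Rightarrow> 'a) set" where
  "boundary_map h \<xi> = (\<lambda>x. h \<circ> x) ` \<xi>"


section \<open>Basic consistency facts\<close>

subsection \<open>Dyadic decompositions as complete prefix codes\<close>

lemma dyadic_interval_Nil: "dyadic_interval [] = {0..1}"
  by (simp add: dyadic_interval_def)

lemma dyadic_interval_Cons:
  "t \<in> dyadic_interval (b # w) \<longleftrightarrow> 2 * t - of_bool b \<in> dyadic_interval w"
  by (cases b) (auto simp: dyadic_interval_def Let_def horner_sum_append field_simps)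

lemma dyadic_interval_subset: "dyadic_interval w \<subseteq> {0..1}"
proof (induction w)
  case Nil
  then show ?case by (simp add: dyadic_interval_Nil)
next
  case (Cons b w)
  then show ?case
    by (cases b) (auto simp: dyadic_interval_Cons subset_iff field_simps dest!: Cons.IH[THEN subsetD])
qed

lemma dyadic_interval_append: "dyadic_interval (u @ v) \<subseteq> dyadic_interval u"
proof (induction u)
  case Nil
  then show ?case using dyadic_interval_subset by (simp add: dyadic_interval_Nil)
next
  case (Cons b u)
  then show ?case by (auto simp: dyadic_interval_Cons)
qed

lemma infinite_dyadic_interval: "infinite (dyadic_interval w)"
  by (auto simp: dyadic_interval_def Let_def divide_strict_right_mono)

lemma range_dyadic_interval:
  "range dyadic_interval =
     {{real j / 2 ^ m .. real (j + 1) / 2 ^ m} | j m. j < (2::nat) ^ m}" (is "_ = ?R")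
proof (intro equalityI subsetI)
  fix I assume "I \<in> range dyadic_interval"
  then obtain w where I: "I = dyadic_interval w" by auto
  define j :: nat where "j = horner_sum of_bool 2 (rev w)"
  have j: "j < 2 ^ length w"
    unfolding j_def using horner_sum_of_bool_2_less[of "rev w", where 'a = nat] by simp
  have r: "(horner_sum of_bool 2 bs :: real) = real (horner_sum of_bool 2 bs)" for bs
    by (induction bs) auto
  show "I \<in> ?R"
    using j by (auto simp: I dyadic_interval_def Let_def r j_def add.commute)
next
  have *: "\<exists>w. length w = m \<and> horner_sum of_bool 2 (rev w) = real j" if "j < 2 ^ m" for j m :: nat
    using that
  proof (induction m arbitrary: j)
    case 0
    then show ?case by simp
  next
    case (Suc m)
    then have "j div 2 < 2 ^ m" by auto
    then obtain w where "length w = m" "horner_sum of_bool 2 (rev w) = real (j div 2)"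
      using Suc.IH by blast
    moreover have "real j = of_bool (odd j) + 2 * real (j div 2)"
      by (metis mod2_eq_if mod_mult_div_eq of_bool_def of_nat_add of_nat_mult of_nat_numeral
          of_nat_0 of_nat_1)
    ultimately show ?case by (intro exI[of _ "w @ [odd j]"]) simp
  qed
  fix I assume "I \<in> ?R"
  then obtain j m :: nat where I: "I = {real j / 2 ^ m .. real (j + 1) / 2 ^ m}" and "j < 2 ^ m"
    by auto
  then obtain w where "length w = m" "horner_sum of_bool 2 (rev w) = real j"
    using * by blast
  then have "I = dyadic_interval w"
    by (simp add: I dyadic_interval_def Let_def add.commute)
  then show "I \<in> range dyadic_interval" by simp
qed

lemma incomparable_dyadic_intervals:
  assumes "\<not> prefix u v" "\<not> prefix v u"
    and "s \<in> dyadic_interval u \<inter> dyadic_interval v" "t \<in> dyadic_interval u \<inter> dyadic_interval v"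
  shows "s = t"
  using assms
proof (induction u arbitrary: v s t)
  case Nil
  then show ?case by simp
next
  case (Cons a u)
  then obtain b v' where v: "v = b # v'" by (cases v) auto
  show ?case
  proof (cases "a = b")
    case True
    then have "2 * s - of_bool a = 2 * t - of_bool a"
      using Cons.prems by (intro Cons.IH[of v']) (auto simp: v dyadic_interval_Cons)
    then show ?thesis by simp
  next
    case False
    have "r = 1 / 2" if "r \<in> dyadic_interval (a # u) \<inter> dyadic_interval v" for r
      using that False dyadic_interval_subset[of u] dyadic_interval_subset[of v']
      by (cases a; cases b) (auto simp: v dyadic_interval_Cons subset_iff dest!: spec)
    then show ?thesis using Cons.prems by metis
  qed
qed

lemma incomparable_finite:
  assumes "\<not> prefix u v" "\<not> prefix v u"
  shows "finite (dyadic_interval u \<inter> dyadic_interval v)"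
proof (cases "dyadic_interval u \<inter> dyadic_interval v = {}")
  case False
  then obtain s where "s \<in> dyadic_interval u \<inter> dyadic_interval v" by blast
  then have "dyadic_interval u \<inter> dyadic_interval v \<subseteq> {s}"
    using incomparable_dyadic_intervals[OF assms] by blast
  then show ?thesis by (rule finite_subset) simp
qed simp

lemma inj_dyadic_interval: "inj dyadic_interval"
proof (rule injI, rule ccontr)
  fix u v assume eq: "dyadic_interval u = dyadic_interval v" and "u \<noteq> v"
  have *: "diameter (dyadic_interval w) = 1 / 2 ^ length w" for w
    by (simp add: dyadic_interval_def Let_def divide_right_mono diameter_closed_interval
        add_divide_distrib)
  have "length u = length v"
    using *[of u] *[of v] by (simp add: eq)
  then have "\<not> prefix u v" "\<not> prefix v u"
    using \<open>u \<noteq> v\<close> by (auto simp: prefix_def)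
  then have "finite (dyadic_interval u \<inter> dyadic_interval v)"
    by (rule incomparable_finite)
  then show False
    using infinite_dyadic_interval[of u] by (simp add: eq)
qed

lemma dyadic_intervals_cover:
  "t \<in> {0..1} \<Longrightarrow> \<exists>w. length w = n \<and> t \<in> dyadic_interval w"
proof (induction n arbitrary: t)
  case 0
  then show ?case by (simp add: dyadic_interval_Nil)
next
  case (Suc n)
  define b where "b \<longleftrightarrow> t > 1 / 2"
  have "2 * t - of_bool b \<in> {0..1}" using Suc.prems by (auto simp: b_def)
  then obtain w where "length w = n" "2 * t - of_bool b \<in> dyadic_interval w"
    using Suc.IH by blast
  then show ?case by (intro exI[of _ "b # w"]) (simp add: dyadic_interval_Cons)
qed

lemma shift_eq_prefix:
  assumes "u @- x = v @- y" "length u \<le> length v"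
  shows "prefix u v"
proof -
  have "u = take (length u) v"
    using arg_cong[OF assms(1), of "stake (length u)"] assms(2) by (simp add: stake_shift)
  then show ?thesis by (metis take_is_prefix)
qed

lemma dyadic_decomposition_iff:
  "dyadic_decomposition A \<longleftrightarrow> finite A \<and> (\<forall>x. \<exists>!w. w \<in> A \<and> (\<exists>y. x = w @- y))"
proof
  assume A: "dyadic_decomposition A"
  then have fin: "finite A" and cov: "(\<Union>w\<in>A. dyadic_interval w) = {0..1}"
    by (auto simp: dyadic_decomposition_def)
  have "finite (dyadic_interval u \<inter> dyadic_interval v)" if "u \<in> A" "v \<in> A" "u \<noteq> v" for u v
  proof (cases "dyadic_interval u \<inter> dyadic_interval v = {}")
    case False
    then obtain s where "s \<in> dyadic_interval u \<inter> dyadic_interval v" by blast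
    then have "dyadic_interval u \<inter> dyadic_interval v \<subseteq> {s}"
      using A that unfolding dyadic_decomposition_def by blast
    then show ?thesis by (rule finite_subset) simp
  qed simp
  then have incomp: "\<not> prefix u v" if "u \<in> A" "v \<in> A" "u \<noteq> v" for u v
    using that infinite_dyadic_interval[of v] dyadic_interval_append[of u]
    by (metis inf.absorb2 prefix_def)
  have "\<exists>w. w \<in> A \<and> (\<exists>y. x = w @- y)" for x
  proof (rule ccontr)
    assume no: "\<nexists>w. w \<in> A \<and> (\<exists>y. x = w @- y)"
    obtain n where n: "\<And>w. w \<in> A \<Longrightarrow> length w \<le> n"
      using fin by (meson finite_imageI finite_nat_set_iff_bounded_le image_eqI)
    define u where "u = stake n x"
    have "\<not> prefix w u" if "w \<in> A" for w
      using no that unfolding u_def prefix_def by (metis shift_append stake_sdrop)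
    moreover have "\<not> prefix u w" if "w \<in> A" for w
      using n[OF that] calculation[OF that] by (auto simp: u_def prefix_def)
    ultimately have "finite (\<Union>w\<in>A. dyadic_interval u \<inter> dyadic_interval w)"
      using fin by (intro finite_UN_I incomparable_finite) auto
    moreover have "(\<Union>w\<in>A. dyadic_interval u \<inter> dyadic_interval w) = dyadic_interval u"
      using cov dyadic_interval_subset[of u] by blast
    ultimately show False using infinite_dyadic_interval by metis
  qed
  moreover have "u = v" if "u \<in> A" "v \<in> A" "u @- y = v @- z" for u v y z
    using that incomp shift_eq_prefix by (metis nle_le)
  ultimately show "finite A \<and> (\<forall>x. \<exists>!w. w \<in> A \<and> (\<exists>y. x = w @- y))"
    using fin by metis
next
  assume R: "finite A \<and> (\<forall>x. \<exists>!w. w \<in> A \<and> (\<exists>y. x = w @- y))"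
  have cov: "t \<in> (\<Union>w\<in>A. dyadic_interval w)" if t: "t \<in> {0..1}" for t
  proof -
    obtain n where n: "\<And>w. w \<in> A \<Longrightarrow> length w \<le> n"
      using R by (meson finite_imageI finite_nat_set_iff_bounded_le image_eqI)
    obtain w where w: "length w = n" "t \<in> dyadic_interval w"
      using dyadic_intervals_cover[OF t] by blast
    obtain v y where v: "v \<in> A" "w @- sconst True = v @- y"
      using R by metis
    then have "prefix v w" using n[OF v(1)] w(1) shift_eq_prefix by metis
    then show ?thesis
      using v(1) w(2) dyadic_interval_append by (fastforce simp: prefix_def)
  qed
  have "\<not> prefix u v" if "u \<in> A" "v \<in> A" "u \<noteq> v" for u v
    using R that by (metis prefix_def shift_append)
  then have "s = t" if "u \<in> A" "v \<in> A" "u \<noteq> v"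
    "s \<in> dyadic_interval u \<inter> dyadic_interval v" "t \<in> dyadic_interval u \<inter> dyadic_interval v" for u v s t
    using that incomparable_dyadic_intervals by metis
  moreover have "(\<Union>w\<in>A. dyadic_interval w) = {0..1}"
    using cov dyadic_interval_subset by (intro equalityI UN_least subsetI) blast+
  ultimately show "dyadic_decomposition A"
    using R by (simp add: dyadic_decomposition_def)
qed

subsection \<open>The group structure\<close>

lemma thompson_V_iff:
  "f \<in> carrier thompson_V \<longleftrightarrow>
     bij f \<and> (\<exists>n. \<forall>w. length w = n \<longrightarrow> (\<exists>v. \<forall>x. f (w @- x) = v @- x))"
proof
  assume "f \<in> carrier thompson_V"
  then obtain A B \<sigma> where "dyadic_decomposition A" "dyadic_decomposition B"
    and \<sigma>: "bij_betw \<sigma> A B" and f: "\<And>w x. w \<in> A \<Longrightarrow> f (w @- x) = \<sigma> w @- x"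
    by (auto simp: thompson_V_def prefix_replacement_def)
  then have A: "finite A" "\<And>x. \<exists>!w. w \<in> A \<and> (\<exists>y. x = w @- y)"
    and B: "\<And>x. \<exists>!w. w \<in> B \<and> (\<exists>y. x = w @- y)"
    by (auto simp: dyadic_decomposition_iff)
  have "inj f"
  proof (rule injI)
    fix x y assume eq: "f x = f y"
    obtain u x' where u: "u \<in> A" "x = u @- x'" using A by metis
    obtain v y' where v: "v \<in> A" "y = v @- y'" using A by metis
    have "\<sigma> u @- x' = \<sigma> v @- y'" using eq u v f by metis
    moreover have "\<sigma> u \<in> B" "\<sigma> v \<in> B" using \<sigma> u v by (auto simp: bij_betw_def)
    ultimately have "\<sigma> u = \<sigma> v" using B by metis
    then have "u = v" using \<sigma> u v by (auto simp: bij_betw_def inj_on_def)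
    then show "x = y" using \<open>\<sigma> u @- x' = \<sigma> v @- y'\<close> u v by (simp add: shift_left_inj)
  qed
  moreover have "surj f"
  proof (unfold surj_def, rule allI)
    fix y
    obtain v y' where "v \<in> B" "y = v @- y'" using B by metis
    then obtain u where "u \<in> A" "v = \<sigma> u" using \<sigma> by (auto simp: bij_betw_def)
    then show "\<exists>x. y = f x" using f \<open>y = v @- y'\<close> by metis
  qed
  moreover obtain n where n: "\<And>w. w \<in> A \<Longrightarrow> length w \<le> n"
    using A(1) by (meson finite_imageI finite_nat_set_iff_bounded_le image_eqI)
  have "\<exists>v. \<forall>x. f (w @- x) = v @- x" if "length w = n" for w
  proof -
    obtain u y where u: "u \<in> A" "w @- sconst True = u @- y"
      using A(2) by metis
    then have "prefix u w" using n[OF u(1)] that shift_eq_prefix by metis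
    then obtain z where "w = u @ z" by (auto simp: prefix_def)
    then have "\<forall>x. f (w @- x) = (\<sigma> u @ z) @- x" using f u by simp
    then show ?thesis by blast
  qed
  ultimately show "bij f \<and> (\<exists>n. \<forall>w. length w = n \<longrightarrow> (\<exists>v. \<forall>x. f (w @- x) = v @- x))"
    by (auto simp: bij_def)
next
  assume "bij f \<and> (\<exists>n. \<forall>w. length w = n \<longrightarrow> (\<exists>v. \<forall>x. f (w @- x) = v @- x))"
  then obtain n where "bij f" and "\<forall>w. length w = n \<longrightarrow> (\<exists>v. \<forall>x. f (w @- x) = v @- x)"
    by blast
  then obtain \<sigma> where f: "\<And>w x. length w = n \<Longrightarrow> f (w @- x) = \<sigma> w @- x"
    by metis
  define A where "A = {w :: bool list. length w = n}"
  have finA: "finite A"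
    using finite_lists_length_eq[of "UNIV :: bool set" n] by (simp add: A_def)
  have dA: "\<exists>!w. w \<in> A \<and> (\<exists>y. x = w @- y)" for x
  proof (rule ex1I[of _ "stake n x"])
    show "stake n x \<in> A \<and> (\<exists>y. x = stake n x @- y)"
      by (simp add: A_def) (metis stake_sdrop)
  qed (auto simp: A_def stake_shift)
  have inj: "u = v" if "u \<in> A" "v \<in> A" "\<sigma> u @- x = \<sigma> v @- y" for u v x y
  proof -
    have "f (u @- x) = f (v @- y)" using that f by (simp add: A_def)
    then have "u @- x = v @- y" using \<open>bij f\<close> by (simp add: bij_def inj_eq)
    then show ?thesis using that dA by metis
  qed
  have "\<exists>w. w \<in> \<sigma> ` A \<and> (\<exists>y. x = w @- y)" for x
  proof -
    obtain y where "x = f y" using \<open>bij f\<close> by (metis bij_pointE)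
    moreover obtain u z where "u \<in> A" "y = u @- z" using dA by metis
    ultimately show ?thesis using f by (auto simp: A_def)
  qed
  then have "\<exists>!w. w \<in> \<sigma> ` A \<and> (\<exists>y. x = w @- y)" for x
    proof (rule ex_ex1I)
    fix u v assume "u \<in> \<sigma> ` A \<and> (\<exists>y. x = u @- y)" "v \<in> \<sigma> ` A \<and> (\<exists>y. x = v @- y)"
    then obtain a b y z where "a \<in> A" "b \<in> A" "u = \<sigma> a" "v = \<sigma> b" "\<sigma> a @- y = \<sigma> b @- z"
      by blast
    then show "u = v" using inj by blast
  qed
  then have "dyadic_decomposition (\<sigma> ` A)" "dyadic_decomposition A"
    using finA dA by (simp_all add: dyadic_decomposition_iff)
  moreover have "bij_betw \<sigma> A (\<sigma> ` A)"
    using inj by (auto intro!: inj_on_imp_bij_betw inj_onI)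
  ultimately have "prefix_replacement A (\<sigma> ` A) \<sigma> f"
    using f by (simp add: prefix_replacement_def A_def)
  then show "f \<in> carrier thompson_V" by (auto simp: thompson_V_def)
qed

lemma group_thompson_V: "group thompson_V"
proof (rule groupI)
  have simps: "f \<otimes>\<^bsub>thompson_V\<^esub> g = f \<circ> g" "\<one>\<^bsub>thompson_V\<^esub> = id" for f g
    by (simp_all add: thompson_V_def)
  fix f assume f: "f \<in> carrier thompson_V"
  show "\<one>\<^bsub>thompson_V\<^esub> \<otimes>\<^bsub>thompson_V\<^esub> f = f" by (simp add: simps)
  obtain A B \<sigma> where p: "prefix_replacement A B \<sigma> f"
    using f by (auto simp: thompson_V_def)
  have "bij f" using f by (simp add: thompson_V_iff)
  have "inv_into UNIV f (v @- x) = inv_into A \<sigma> v @- x" if "v \<in> B" for v x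
  proof -
    have "\<sigma> (inv_into A \<sigma> v) = v" "inv_into A \<sigma> v \<in> A"
      using p that by (auto simp: prefix_replacement_def bij_betw_def f_inv_into_f inv_into_into)
    then have "f (inv_into A \<sigma> v @- x) = v @- x"
      using p by (simp add: prefix_replacement_def)
    then show ?thesis using \<open>bij f\<close> by (metis bij_inv_eq_iff)
  qed
  then have "prefix_replacement B A (inv_into A \<sigma>) (inv_into UNIV f)"
    using p by (auto simp: prefix_replacement_def bij_betw_inv_into)
  then have "inv_into UNIV f \<in> carrier thompson_V" by (auto simp: thompson_V_def)
  moreover have "inv_into UNIV f \<circ> f = id" using \<open>bij f\<close> by (simp add: bij_def)
  ultimately show "\<exists>h\<in>carrier thompson_V. h \<otimes>\<^bsub>thompson_V\<^esub> f = \<one>\<^bsub>thompson_V\<^esub>"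
    by (auto simp: simps)
  fix g assume g: "g \<in> carrier thompson_V"
  obtain m where m: "\<And>w. length w = m \<Longrightarrow> \<exists>v. \<forall>x. f (w @- x) = v @- x"
    using f by (auto simp: thompson_V_iff)
  obtain n where n: "\<And>w. length w = n \<Longrightarrow> \<exists>v. \<forall>x. g (w @- x) = v @- x"
    using g by (auto simp: thompson_V_iff)
  have "\<exists>v. \<forall>x. (f \<circ> g) (w @- x) = v @- x" if w: "length w = n + m" for w
  proof -
    obtain v where v: "\<And>x. g (take n w @- x) = v @- x" using n[of "take n w"] w by auto
    define u where "u = v @ drop n w"
    have "g (w @- x) = u @- x" for x
      using v[of "drop n w @- x"] by (metis append_take_drop_id shift_append u_def)
    moreover obtain u' where "\<And>x. f (take m u @- x) = u' @- x"
      using m[of "take m u"] w unfolding u_def by (metis length_append length_drop length_take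
          add_diff_cancel_left' le_add2 min.absorb2)
    then have "f (u @- x) = (u' @ drop m u) @- x" for x
      by (metis append_take_drop_id shift_append)
    ultimately show ?thesis by (metis comp_apply)
  qed
  then show "f \<otimes>\<^bsub>thompson_V\<^esub> g \<in> carrier thompson_V"
    using f g by (auto simp: thompson_V_iff simps intro: bij_comp)
  fix h
  show "f \<otimes>\<^bsub>thompson_V\<^esub> g \<otimes>\<^bsub>thompson_V\<^esub> h = f \<otimes>\<^bsub>thompson_V\<^esub> (g \<otimes>\<^bsub>thompson_V\<^esub> h)"
    by (simp add: simps comp_assoc)
next
  have "\<exists>n. \<forall>w. length w = n \<longrightarrow> (\<exists>v. \<forall>x. id (w @- x) = v @- x)" by auto
  then show "\<one>\<^bsub>thompson_V\<^esub> \<in> carrier thompson_V"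
    using thompson_V_iff[of id] by (simp add: thompson_V_def)
qed

subsection \<open>The boundary does not depend on the basepoint\<close>

lemma gromov_product_basepoint: "gromov_product p x y - dist p q \<le> gromov_product q x y"
  using dist_triangle[of p x q] dist_triangle[of p y q]
  by (simp add: gromov_product_def field_simps)

lemma filterlim_gromov_product_basepoint:
  assumes "filterlim (\<lambda>i. gromov_product p (y i) (z i)) at_top F"
  shows "filterlim (\<lambda>i. gromov_product q (y i) (z i)) at_top F"
proof (rule filterlim_at_top_mono)
  show "filterlim (\<lambda>i. - dist p q + gromov_product p (y i) (z i)) at_top F"
    by (intro filterlim_tendsto_add_at_top[OF tendsto_const] assms)
  show "\<forall>\<^sub>F i in F. - dist p q + gromov_product p (y i) (z i) \<le> gromov_product q (y i) (z i)"
    using gromov_product_basepoint[of p _ _ q] by (intro always_eventually) (simp add: field_simps)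
qed

lemma gromov_boundary_basepoint: "gromov_boundary p = gromov_boundary q"
proof -
  have "converges_at_infinity p x \<longleftrightarrow> converges_at_infinity q x" for x
    unfolding converges_at_infinity_def case_prod_beta
    using filterlim_gromov_product_basepoint[where y = "\<lambda>i. x (fst i)" and z = "\<lambda>i. x (snd i)"]
    by blast
  moreover have "filterlim (\<lambda>i. gromov_product p (y i) (z i)) at_top sequentially \<longleftrightarrow>
      filterlim (\<lambda>i. gromov_product q (y i) (z i)) at_top sequentially" for y z
    using filterlim_gromov_product_basepoint by blast
  ultimately show ?thesis by (simp add: gromov_boundary_def infinity_rel_def)
qed

lemma equiv_infinity_rel:
  fixes p :: "'a::metric_space"
  assumes "gromov_hyperbolic TYPE('a)"
  shows "equiv {x. converges_at_infinity p x} (infinity_rel p)"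
proof (rule equivI)
  show "infinity_rel p \<subseteq> {x. converges_at_infinity p x} \<times> {x. converges_at_infinity p x}"
    by (auto simp: infinity_rel_def)
  have "filterlim (\<lambda>i. gromov_product p (x i) (x i)) at_top sequentially"
    if "converges_at_infinity p x" for x
  proof -
    have "filterlim (\<lambda>i::nat. (i, i)) (sequentially \<times>\<^sub>F sequentially) sequentially"
      by (intro filterlim_Pair filterlim_ident)
    from filterlim_compose[OF that[unfolded converges_at_infinity_def] this] show ?thesis
      by simp
  qed
  then show "refl_on {x. converges_at_infinity p x} (infinity_rel p)"
    by (auto simp: refl_on_def infinity_rel_def)
  show "sym (infinity_rel p)"
    by (auto simp: sym_def infinity_rel_def gromov_product_def dist_commute add.commute)
  obtain \<delta> where \<delta>: "\<And>x y z w :: 'a. gromov_product w x z \<ge> min (gromov_product w x y) (gromov_product w y z) - \<delta>"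
    using assms by (auto simp: gromov_hyperbolic_def delta_hyperbolic_def)
  show "trans (infinity_rel p)"
  proof (rule transI)
    fix x y z assume xy: "(x, y) \<in> infinity_rel p" and yz: "(y, z) \<in> infinity_rel p"
    have "filterlim (\<lambda>i. gromov_product p (x i) (z i)) at_top sequentially"
      unfolding filterlim_at_top
    proof
      fix K
      have "\<forall>\<^sub>F i in sequentially. K + \<delta> \<le> gromov_product p (x i) (y i)"
        "\<forall>\<^sub>F i in sequentially. K + \<delta> \<le> gromov_product p (y i) (z i)"
        using xy yz by (auto simp: infinity_rel_def filterlim_at_top)
      then show "\<forall>\<^sub>F i in sequentially. K \<le> gromov_product p (x i) (z i)"
      proof eventually_elim
        case (elim i)
        then show ?case using \<delta>[of p "x i" "y i" "z i"] by linarith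
      qed
    qed
    then show "(x, z) \<in> infinity_rel p" using xy yz by (auto simp: infinity_rel_def)
  qed
qed

end

theory Submission
  imports Defs "HOL-Library.Ramsey"
begin

text \<open>
  Suppose that some orbit is unbounded. The group V is rich in pairs of commuting subgroups: elements
  with disjoint supports commute. The geometric input is that two commuting isometries \<open>a\<close> and \<open>k\<close>
  of a hyperbolic space span a parallelogram \<open>p, a p, k p, a k p\<close>, and thin quadrilaterals force
  \<open>a p\<close> to stay close to \<open>k p\<close> or to \<open>k\<^sup>-\<^sup>1 p\<close> for at least about half of the shorter side (lemma
  \<open>parallelogram\<close>). Hence, if \<open>S\<close> and \<open>T\<close> are commuting subgroups with unbounded orbits, the orbit
  of \<open>S\<close> has at least one limit at infinity (in fact at most two), every limit of \<open>S\<close> is also a limit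
  of \<open>T\<close>, and each limit of \<open>S\<close> is fixed by all isometries that commute with \<open>S\<close> (lemmas
  \<open>commuting_orbit_limit\<close>, \<open>commuting_limit_transfer\<close> and \<open>commuting_fixes_limit\<close>).

  For a word \<open>a\<close> let \<open>G\<^sub>a\<close> be the subgroup of elements supported in the cylinder of \<open>a\<close> and \<open>H\<^sub>a\<close>
  the subgroup of elements fixing that cylinder pointwise; they commute with each other. Every element
  of V is a product of four elements of the groups \<open>H\<^sub>a\<close> with \<open>a\<close> of length 2 (lemma
  \<open>thompson_V_boundedly_generated\<close>). As the number of factors is bounded, one of these groups has
  unbounded orbits. For nonempty words all \<open>H\<^sub>a\<close> are conjugate, all \<open>G\<^sub>a\<close> are conjugate, and
  \<open>H\<^sub>1 = G\<^sub>0\<close>; so every \<open>G\<^sub>a\<close> has unbounded orbits.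

  Now take a limit \<open>\<xi>\<close> of \<open>G\<^sub>0\<^sub>0\<close>. For any other word \<open>a\<close> of length 2 the groups \<open>G\<^sub>0\<^sub>0\<close> and \<open>G\<^sub>a\<close>
  commute, so \<open>\<xi>\<close> is a limit of \<open>G\<^sub>a\<close> as well and is therefore fixed by \<open>H\<^sub>a\<close>. These groups
  generate V, so V fixes \<open>\<xi>\<close>.
\<close>

section \<open>Sequences converging to infinity\<close>

lemma converges_at_infinity_iff:
  "converges_at_infinity p x \<longleftrightarrow>
     (\<forall>K. \<exists>N. \<forall>i\<ge>N. \<forall>j\<ge>N. K \<le> gromov_product p (x i) (x j))"
proof -
  have "eventually P (sequentially \<times>\<^sub>F sequentially) \<longleftrightarrow> (\<exists>N. \<forall>i\<ge>N. \<forall>j\<ge>N. P (i, j))" for P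
    unfolding eventually_prod_sequentially by blast
  then show ?thesis
    by (simp add: converges_at_infinity_def filterlim_at_top)
qed

lemma gromov_product_self [simp]: "gromov_product p x x = dist p x"
  by (simp add: gromov_product_def)

lemma gromov_product_commute: "gromov_product p x y = gromov_product p y x"
  by (simp add: gromov_product_def dist_commute)

lemma dist_at_infinity:
  assumes "converges_at_infinity p x"
  shows "filterlim (\<lambda>i. dist p (x i)) at_top sequentially"
  unfolding filterlim_at_top eventually_sequentially
  using assms unfolding converges_at_infinity_iff by (metis gromov_product_self)

lemma converges_at_infinity_isometry:
  assumes iso: "\<And>u v. dist (h u) (h v) = dist u v" and x: "converges_at_infinity p x"
  shows "converges_at_infinity p (h \<circ> x)"
  unfolding converges_at_infinity_iff
proof
  fix K
  obtain N where N: "\<And>i j. i \<ge> N \<Longrightarrow> j \<ge> N \<Longrightarrow> K + dist p (h p) \<le> gromov_product p (x i) (x j)"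
    using x unfolding converges_at_infinity_iff by meson
  have "K \<le> gromov_product p ((h \<circ> x) i) ((h \<circ> x) j)" if "i \<ge> N" "j \<ge> N" for i j
  proof -
    have "gromov_product (h p) (h (x i)) (h (x j)) = gromov_product p (x i) (x j)"
      by (simp add: gromov_product_def iso)
    then show ?thesis
      using gromov_product_basepoint[of "h p" "h (x i)" "h (x j)" p] N[OF that]
      by (simp add: dist_commute)
  qed
  then show "\<exists>N. \<forall>i\<ge>N. \<forall>j\<ge>N. K \<le> gromov_product p ((h \<circ> x) i) ((h \<circ> x) j)" by blast
qed

lemma infinity_rel_isometry:
  assumes iso: "\<And>u v. dist (h u) (h v) = dist u v" and xy: "(x, y) \<in> infinity_rel p"
  shows "(h \<circ> x, h \<circ> y) \<in> infinity_rel p"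
proof -
  have "filterlim (\<lambda>i. gromov_product p (x i) (y i)) at_top sequentially"
    using xy by (simp add: infinity_rel_def)
  moreover have "gromov_product (h p) (h u) (h v) = gromov_product p u v" for u v
    by (simp add: gromov_product_def iso)
  ultimately have "filterlim (\<lambda>i. gromov_product (h p) (h (x i)) (h (y i))) at_top sequentially"
    by simp
  from filterlim_gromov_product_basepoint[OF this, of p] show ?thesis
    using xy converges_at_infinity_isometry[of h, OF iso] by (simp add: infinity_rel_def)
qed


section \<open>Commuting isometries of a hyperbolic space\<close>

locale hyperbolic_action = group_action G UNIV \<phi>
  for G :: "('g, 'm) monoid_scheme" (structure) and \<phi> :: "'g \<Rightarrow> 'x::metric_space \<Rightarrow> 'x" +
  fixes p :: 'x and \<delta> :: real
  assumes isometry: "g \<in> carrier G \<Longrightarrow> dist (\<phi> g x) (\<phi> g y) = dist x y"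
    and hyperbolic: "min (gromov_product w x y) (gromov_product w y z) - \<delta> \<le> gromov_product w x z"
    and nonneg: "0 \<le> \<delta>"
begin

sublocale group G
  using group_hom group_hom.axioms(1) by blast

lemma act_mult: "g \<in> carrier G \<Longrightarrow> h \<in> carrier G \<Longrightarrow> \<phi> (g \<otimes> h) x = \<phi> g (\<phi> h x)"
  by (simp add: composition_rule)

lemma act_inv: "g \<in> carrier G \<Longrightarrow> \<phi> (inv g) (\<phi> g x) = x"
  using orbit_sym_aux by blast

lemma act_inv': "g \<in> carrier G \<Longrightarrow> \<phi> g (\<phi> (inv g) x) = x"
  using act_inv[of "inv g"] by simp

abbreviation displacement :: "'g \<Rightarrow> real" where
  "displacement g \<equiv> dist p (\<phi> g p)"

lemma displacement_inv: "g \<in> carrier G \<Longrightarrow> displacement (inv g) = displacement g"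
  using isometry[of g p "\<phi> (inv g) p"] by (simp add: act_inv' dist_commute)

lemma displacement_mult:
  assumes "g \<in> carrier G" "h \<in> carrier G"
  shows "displacement (g \<otimes> h) \<le> displacement g + displacement h"
  using assms dist_triangle[of p "\<phi> g (\<phi> h p)" "\<phi> g p"] by (simp add: act_mult isometry)

definition unbounded_orbit :: "'g set \<Rightarrow> bool" where
  "unbounded_orbit S \<longleftrightarrow> (\<forall>K. \<exists>s\<in>S. K \<le> displacement s)"

definition commuting :: "'g set \<Rightarrow> 'g set \<Rightarrow> bool" where
  "commuting S T \<longleftrightarrow> (\<forall>s\<in>S. \<forall>t\<in>T. s \<otimes> t = t \<otimes> s)"

definition orbit_limit :: "'g set \<Rightarrow> (nat \<Rightarrow> 'x) \<Rightarrow> bool" where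
  "orbit_limit S x \<longleftrightarrow> converges_at_infinity p x \<and> (\<forall>n. \<exists>s\<in>S. x n = \<phi> s p)"

text \<open>For \<open>x\<close> converging to infinity this is the stabilizer of the boundary point that \<open>x\<close>
  represents; a representative is easier to handle than its class.\<close>

definition end_stabilizer :: "(nat \<Rightarrow> 'x) \<Rightarrow> 'g set" where
  "end_stabilizer x = {g \<in> carrier G. (x, \<phi> g \<circ> x) \<in> infinity_rel p}"

lemma unbounded_orbit_conjugate:
  assumes "unbounded_orbit S" "S \<subseteq> carrier G" "g \<in> carrier G"
    and T: "\<And>s. s \<in> S \<Longrightarrow> g \<otimes> s \<otimes> inv g \<in> T" and "T \<subseteq> carrier G"
  shows "unbounded_orbit T"
  unfolding unbounded_orbit_def
proof
  fix K
  obtain s where s: "s \<in> S" "K + 2 * displacement g \<le> displacement s"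
    using assms(1) unfolding unbounded_orbit_def by blast
  have sG: "s \<in> carrier G" using s assms(2) by blast
  have gG: "g \<in> carrier G" by fact
  have "s = inv g \<otimes> ((g \<otimes> s \<otimes> inv g) \<otimes> g)"
    using sG gG by (simp add: m_assoc) (simp flip: m_assoc)
  then have "displacement s \<le> displacement g + (displacement (g \<otimes> s \<otimes> inv g) + displacement g)"
    using displacement_mult[of "inv g" "(g \<otimes> s \<otimes> inv g) \<otimes> g"]
      displacement_mult[of "g \<otimes> s \<otimes> inv g" g] sG gG displacement_inv[OF gG]
    by (smt (verit) inv_closed m_closed)
  then show "\<exists>t\<in>T. K \<le> displacement t"
    using s T[OF s(1)] by (intro bexI[of _ "g \<otimes> s \<otimes> inv g"]) auto
qed

text \<open>The four points \<open>p, a p, k p, a k p\<close> form a parallelogram: opposite sides have equal length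
  because \<open>a\<close> and \<open>k\<close> commute. In a hyperbolic space its diagonals cannot both be much longer than
  the longer side. The lengths of the diagonals are \<open>d(p, a k p) = d(a p, k\<^sup>-\<^sup>1 p)\<close> and
  \<open>d(a p, k p)\<close>, so the bound says that \<open>a p\<close> travels with \<open>k p\<close> or with \<open>k\<^sup>-\<^sup>1 p\<close> for at least
  about half of the shorter side.\<close>

lemma parallelogram:
  assumes a: "a \<in> carrier G" and k: "k \<in> carrier G" and comm: "a \<otimes> k = k \<otimes> a"
  shows "min (displacement a) (displacement k) - \<delta>
    \<le> gromov_product p (\<phi> a p) (\<phi> k p) + gromov_product p (\<phi> a p) (\<phi> (inv k) p)"
proof -
  have ak: "\<phi> a (\<phi> k p) = \<phi> k (\<phi> a p)"
    using a k comm by (metis act_mult)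
  have s1: "dist (\<phi> a p) (\<phi> k (\<phi> a p)) = displacement k"
    unfolding ak[symmetric] using a by (simp add: isometry)
  have s2: "dist (\<phi> k p) (\<phi> k (\<phi> a p)) = displacement a"
    using k by (simp add: isometry)
  have d: "dist (\<phi> a p) (\<phi> (inv k) p) = dist p (\<phi> k (\<phi> a p))"
    using isometry[OF k, of "\<phi> a p" "\<phi> (inv k) p"] k by (simp add: act_inv' dist_commute)
  \<comment> \<open>The comparison through the corner opposite to \<open>p\<close> is the four-point condition for the parallelogram.\<close>
  show ?thesis
    using hyperbolic[of p "\<phi> a p" "\<phi> k (\<phi> a p)" "\<phi> k p"] s1 s2 displacement_inv[OF k]
    unfolding gromov_product_def d by (auto simp: dist_commute field_simps min_def split: if_splits)
qed

lemma travels_together: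
  assumes "a \<in> carrier G" "k \<in> carrier G" "a \<otimes> k = k \<otimes> a"
  obtains k' where "k' = k \<or> k' = inv k"
    and "(min (displacement a) (displacement k) - \<delta>) / 2 \<le> gromov_product p (\<phi> a p) (\<phi> k' p)"
  using parallelogram[OF assms] by (smt (verit) field_sum_of_halves)

text \<open>Of any three far orbit points of \<open>S\<close>, two travel with the same one of \<open>t p\<close> and
  \<open>t\<^sup>-\<^sup>1 p\<close>, for an element \<open>t\<close> of \<open>T\<close> that moves \<open>p\<close> even further; so these two travel together.
  In the absence of compactness, Ramsey's theorem then extracts a convergent sequence from the orbit:
  a set of orbit points that pairwise separate early has at most two elements.\<close>

lemma commuting_orbit_limit:
  assumes S: "S \<subseteq> carrier G" "unbounded_orbit S" and T: "T \<subseteq> carrier G" "unbounded_orbit T"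
    and comm: "commuting S T"
  obtains x where "orbit_limit S x"
proof -
  have "\<forall>n::nat. \<exists>s. s \<in> S \<and> real n \<le> displacement s"
    using S(2) unfolding unbounded_orbit_def by blast
  then obtain a where a: "\<And>n. a n \<in> S" "\<And>n::nat. real n \<le> displacement (a n)"
    by metis
  define x where "x n = \<phi> (a n) p" for n
  \<comment> \<open>The parallelogram bound for a side of length at least \<open>n\<close>, less the \<open>\<delta>\<close> that one more comparison costs.\<close>
  define rate where "rate n = (real n - \<delta>) / 2 - \<delta>" for n
  define colour where
    "colour X = (if rate (Min X) \<le> gromov_product p (x (Min X)) (x (Max X)) then 0 else 1 :: nat)" for X
  have "\<forall>m\<in>UNIV. \<forall>n\<in>UNIV. m \<noteq> n \<longrightarrow> colour {m, n} < 2"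
    by (simp add: colour_def)
  from Ramsey2[OF infinite_UNIV_nat this] obtain Y t where "infinite Y \<and> t < 2 \<and>
      (\<forall>m\<in>Y. \<forall>n\<in>Y. m \<noteq> n \<longrightarrow> colour {m, n} = t)"
    by auto
  then have Y: "infinite Y"
    and t: "\<And>m n. m \<in> Y \<Longrightarrow> n \<in> Y \<Longrightarrow> m \<noteq> n \<Longrightarrow> colour {m, n} = t"
    by auto
  have colour: "colour {m, n} = 0 \<longleftrightarrow> rate m \<le> gromov_product p (x m) (x n)" if "m < n" for m n
    using that by (simp add: colour_def min_def max_def)
  define e where "e = enumerate Y"
  have e: "e i \<in> Y" "i < j \<Longrightarrow> e i < e j" "i \<le> e i" for i j
    unfolding e_def using Y by (auto simp: enumerate_in_set enumerate_mono le_enumerate)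
  have "t = 0"
  proof -
    obtain k where k: "k \<in> T" "real (e 2) \<le> displacement k"
      using T(2) unfolding unbounded_orbit_def by blast
    have "\<exists>k'. (k' = k \<or> k' = inv k) \<and>
      (min (displacement (a m)) (displacement k) - \<delta>) / 2 \<le> gromov_product p (x m) (\<phi> k' p)" for m
      using travels_together[of "a m" k] a(1)[of m] k(1) S(1) T(1) comm
      unfolding x_def commuting_def by (metis subsetD)
    then obtain c where c: "\<And>m. c m = k \<or> c m = inv k"
      and gp: "\<And>m. (min (displacement (a m)) (displacement k) - \<delta>) / 2 \<le> gromov_product p (x m) (\<phi> (c m) p)"
      by metis
    have near: "rate (min m n) \<le> gromov_product p (x m) (x n)"
      if "c m = c n" "m \<le> e 2" "n \<le> e 2" for m n
    proof -
      have "(real m - \<delta>) / 2 \<le> gromov_product p (x m) (\<phi> (c m) p)"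
        using gp[of m] a(2)[of m] k(2) that by (auto simp: field_simps)
      moreover have "(real n - \<delta>) / 2 \<le> gromov_product p (\<phi> (c m) p) (x n)"
        using gp[of n] a(2)[of n] k(2) that by (auto simp: gromov_product_commute field_simps)
      moreover have "rate (min m n) + \<delta> \<le> (real m - \<delta>) / 2" "rate (min m n) + \<delta> \<le> (real n - \<delta>) / 2"
        by (simp_all add: rate_def)
      ultimately show ?thesis
        using hyperbolic[of p "x m" "\<phi> (c m) p" "x n"] by linarith
    qed
    obtain i j :: nat where ij: "i < j" "j \<le> 2" "c (e i) = c (e j)"
    proof -
      have "c (e 0) = c (e 1) \<or> c (e 0) = c (e 2) \<or> c (e 1) = c (e 2)"
        using c by metis
      then show thesis
        using that[of 0 1] that[of 0 2] that[of 1 2] by auto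
    qed
    have le: "e i < e j" "e j \<le> e 2"
      using ij e(2)[of i j] e(2)[of j 2] by (auto simp: le_less)
    then have "colour {e i, e j} = 0"
      using near[of "e i" "e j"] ij by (simp add: colour min_def)
    then show ?thesis using t[of "e i" "e j"] e(1) le by simp
  qed
  have far: "rate (min i j) \<le> gromov_product p (x (e i)) (x (e j))" for i j
  proof -
    have less: "rate i \<le> gromov_product p (x (e i)) (x (e j))" if "i < j" for i j
    proof -
      have "rate (e i) \<le> gromov_product p (x (e i)) (x (e j))"
        using colour[OF e(2)[OF that]] t[OF e(1) e(1)] \<open>t = 0\<close> e(2)[OF that] by fastforce
      moreover have "rate i \<le> rate (e i)"
        using e(3)[of i] by (simp add: rate_def divide_right_mono)
      ultimately show ?thesis by linarith
    qed
    show ?thesis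
    proof (cases i j rule: linorder_cases)
      case equal
      then show ?thesis
        using a(2)[of "e j"] e(3)[of j] nonneg by (simp add: rate_def x_def field_simps)
    next
      case greater
      then show ?thesis
        using less[of j i] by (simp add: gromov_product_commute[of p "x (e i)"])
    qed (use less in simp)
  qed
  have "converges_at_infinity p (x \<circ> e)"
    unfolding converges_at_infinity_iff
  proof
    fix K
    obtain N :: nat where N: "2 * K + 3 * \<delta> \<le> real N" using real_arch_simple by blast
    have "K \<le> gromov_product p ((x \<circ> e) i) ((x \<circ> e) j)" if "i \<ge> N" "j \<ge> N" for i j
    proof -
      have "K \<le> rate N"
        unfolding rate_def using N by (simp add: field_simps)
      also have "\<dots> \<le> rate (min i j)"
        using that by (simp add: rate_def divide_right_mono)
      finally show ?thesis using far[of i j] by simp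
    qed
    then show "\<exists>N. \<forall>i\<ge>N. \<forall>j\<ge>N. K \<le> gromov_product p ((x \<circ> e) i) ((x \<circ> e) j)" by blast
  qed
  then have "orbit_limit S (x \<circ> e)"
    using a(1) by (auto simp: orbit_limit_def x_def)
  then show ?thesis by (rule that)
qed

text \<open>Hyperbolicity makes convergence of \<open>y\<close> automatic: \<open>y i\<close> travels with \<open>x i\<close>, then with \<open>x j\<close>,
  then with \<open>y j\<close>, which costs \<open>\<delta>\<close> twice.\<close>

lemma infinity_relI:
  assumes x: "converges_at_infinity p x"
    and xy: "filterlim (\<lambda>i. gromov_product p (x i) (y i)) at_top sequentially"
  shows "(x, y) \<in> infinity_rel p"
proof -
  have "converges_at_infinity p y"
    unfolding converges_at_infinity_iff
  proof
    fix K
    obtain N where N: "\<And>i j. i \<ge> N \<Longrightarrow> j \<ge> N \<Longrightarrow> K + 2 * \<delta> \<le> gromov_product p (x i) (x j)"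
      using x unfolding converges_at_infinity_iff by meson
    obtain M where M: "\<And>i. i \<ge> M \<Longrightarrow> K + 2 * \<delta> \<le> gromov_product p (x i) (y i)"
      using xy unfolding filterlim_at_top eventually_sequentially by meson
    have "K \<le> gromov_product p (y i) (y j)" if "i \<ge> max M N" "j \<ge> max M N" for i j
    proof -
      have "K + \<delta> \<le> gromov_product p (x i) (y j)"
        using hyperbolic[of p "x i" "x j" "y j"] N[of i j] M[of j] that nonneg by simp
      moreover have "K + \<delta> \<le> gromov_product p (y i) (x i)"
        using M[of i] that nonneg by (simp add: gromov_product_commute)
      ultimately show ?thesis using hyperbolic[of p "y i" "x i" "y j"] by simp
    qed
    then show "\<exists>N. \<forall>i\<ge>N. \<forall>j\<ge>N. K \<le> gromov_product p (y i) (y j)" by blast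
  qed
  then show ?thesis using assms by (simp add: infinity_rel_def)
qed

text \<open>The partner of a far orbit point \<open>a p\<close> is \<open>k p\<close> or \<open>k\<^sup>-\<^sup>1 p\<close>, for any \<open>k\<close> in \<open>T\<close> that moves
  \<open>p\<close> far; as \<open>T\<close> is closed under inverses, both points lie in its orbit.\<close>

lemma commuting_limit_transfer:
  assumes S: "S \<subseteq> carrier G" and x: "orbit_limit S x"
    and T: "T \<subseteq> carrier G" "unbounded_orbit T" "\<And>t. t \<in> T \<Longrightarrow> inv t \<in> T" and comm: "commuting S T"
  obtains y where "orbit_limit T y" "(x, y) \<in> infinity_rel p"
proof -
  have "\<exists>t\<in>T. (min (dist p (x n)) (real n) - \<delta>) / 2 \<le> gromov_product p (x n) (\<phi> t p)" for n
  proof -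
    obtain s where s: "s \<in> S" "x n = \<phi> s p" using x unfolding orbit_limit_def by blast
    obtain k where k: "k \<in> T" "real n \<le> displacement k"
      using T(2) unfolding unbounded_orbit_def by blast
    obtain k' where k': "k' = k \<or> k' = inv k"
      and "(min (displacement s) (displacement k) - \<delta>) / 2 \<le> gromov_product p (\<phi> s p) (\<phi> k' p)"
      using travels_together[of s k] s k S T(1) comm unfolding commuting_def by (metis subsetD)
    then have "(min (dist p (x n)) (real n) - \<delta>) / 2 \<le> gromov_product p (x n) (\<phi> k' p)"
      using s k by (auto simp: field_simps)
    then show ?thesis using k k' T(3) by blast
  qed
  then obtain t where t: "\<And>n. t n \<in> T"
    and gp: "\<And>n. (min (dist p (x n)) (real n) - \<delta>) / 2 \<le> gromov_product p (x n) (\<phi> (t n) p)"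
    by metis
  have "filterlim (\<lambda>n. gromov_product p (x n) (\<phi> (t n) p)) at_top sequentially"
    unfolding filterlim_at_top
  proof
    fix K
    have "\<forall>\<^sub>F n in sequentially. 2 * K + \<delta> \<le> dist p (x n)"
      using x dist_at_infinity unfolding orbit_limit_def filterlim_at_top by blast
    moreover have "\<forall>\<^sub>F n in sequentially. 2 * K + \<delta> \<le> real n"
      using filterlim_real_sequentially unfolding filterlim_at_top by blast
    ultimately show "\<forall>\<^sub>F n in sequentially. K \<le> gromov_product p (x n) (\<phi> (t n) p)"
    proof eventually_elim
      case (elim n)
      then show ?case using gp[of n] by (auto simp: min_def field_simps split: if_splits)
    qed
  qed
  then have "(x, \<lambda>n. \<phi> (t n) p) \<in> infinity_rel p"
    using x by (intro infinity_relI) (auto simp: orbit_limit_def)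
  moreover from this have "orbit_limit T (\<lambda>n. \<phi> (t n) p)"
    using t by (auto simp: orbit_limit_def infinity_rel_def)
  ultimately show ?thesis using that by blast
qed

text \<open>An isometry \<open>t\<close> commuting with \<open>s\<close> moves \<open>s p\<close> exactly as far as \<open>p\<close>, hence moves a sequence
  of such points by a bounded amount.\<close>

lemma commuting_fixes_limit:
  assumes S: "S \<subseteq> carrier G" and x: "orbit_limit S x"
    and T: "T \<subseteq> carrier G" and comm: "commuting S T"
  shows "T \<subseteq> end_stabilizer x"
proof
  fix t assume t: "t \<in> T"
  have d: "dist (x n) (\<phi> t (x n)) = displacement t" for n
  proof -
    obtain s where s: "s \<in> S" "x n = \<phi> s p" using x unfolding orbit_limit_def by blast
    then have "\<phi> t (\<phi> s p) = \<phi> s (\<phi> t p)"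
      using t S T comm unfolding commuting_def by (metis act_mult subsetD)
    then show ?thesis using s S isometry[of s] by auto
  qed
  have "dist p (x n) - displacement t \<le> gromov_product p (x n) ((\<phi> t \<circ> x) n)" for n
    using dist_triangle[of p "x n" "\<phi> t (x n)"] d[of n]
    by (simp add: gromov_product_def dist_commute field_simps)
  then have "\<forall>\<^sub>F n in sequentially. dist p (x n) - displacement t \<le> gromov_product p (x n) ((\<phi> t \<circ> x) n)"
    by (intro always_eventually allI)
  moreover have "filterlim (\<lambda>n. dist p (x n) - displacement t) at_top sequentially"
    using dist_at_infinity x filterlim_tendsto_add_at_top[OF tendsto_const, of "\<lambda>n. dist p (x n)" _ "- displacement t"]
    by (auto simp: orbit_limit_def)
  ultimately have "filterlim (\<lambda>n. gromov_product p (x n) ((\<phi> t \<circ> x) n)) at_top sequentially"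
    by (rule filterlim_at_top_mono[rotated])
  then show "t \<in> end_stabilizer x"
    using x t T infinity_relI[of x "\<phi> t \<circ> x"] by (auto simp: end_stabilizer_def orbit_limit_def)
qed

lemma equiv_ends: "equiv {x. converges_at_infinity p x} (infinity_rel p)"
proof (rule equiv_infinity_rel)
  show "gromov_hyperbolic TYPE('x)"
    unfolding gromov_hyperbolic_def delta_hyperbolic_def using hyperbolic nonneg by blast
qed

lemma ends_sym: "(x, y) \<in> infinity_rel p \<Longrightarrow> (y, x) \<in> infinity_rel p"
  using equiv_ends by (meson equivE symD)

lemma ends_trans:
  "(x, y) \<in> infinity_rel p \<Longrightarrow> (y, z) \<in> infinity_rel p \<Longrightarrow> (x, z) \<in> infinity_rel p"
  using equiv_ends by (meson equivE transD)

lemma end_stabilizer_cong: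
  assumes "(x, y) \<in> infinity_rel p"
  shows "end_stabilizer x \<subseteq> end_stabilizer y"
proof
  fix g assume "g \<in> end_stabilizer x"
  then have g: "g \<in> carrier G" "(x, \<phi> g \<circ> x) \<in> infinity_rel p"
    by (auto simp: end_stabilizer_def)
  have "(\<phi> g \<circ> x, \<phi> g \<circ> y) \<in> infinity_rel p"
    by (rule infinity_rel_isometry[OF isometry[OF g(1)] assms])
  then show "g \<in> end_stabilizer y"
    using g assms by (auto simp: end_stabilizer_def intro: ends_sym ends_trans)
qed

lemma end_stabilizer_mult:
  assumes "g \<in> end_stabilizer x" "h \<in> end_stabilizer x"
  shows "g \<otimes> h \<in> end_stabilizer x"
proof -
  have gG: "g \<in> carrier G" "h \<in> carrier G" and g: "(x, \<phi> g \<circ> x) \<in> infinity_rel p"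
    and h: "(x, \<phi> h \<circ> x) \<in> infinity_rel p"
    using assms by (auto simp: end_stabilizer_def)
  have "(\<phi> g \<circ> x, \<phi> g \<circ> (\<phi> h \<circ> x)) \<in> infinity_rel p"
    by (rule infinity_rel_isometry[OF isometry[OF gG(1)] h])
  then have "(x, \<phi> g \<circ> (\<phi> h \<circ> x)) \<in> infinity_rel p"
    by (rule ends_trans[OF g])
  moreover have "\<phi> g \<circ> (\<phi> h \<circ> x) = \<phi> (g \<otimes> h) \<circ> x"
    using gG by (auto simp: act_mult)
  ultimately show ?thesis using gG by (simp add: end_stabilizer_def)
qed

lemma boundary_map_fixes_end:
  assumes G: "carrier G \<subseteq> end_stabilizer x" and g: "g \<in> carrier G"
  shows "boundary_map (\<phi> g) (infinity_rel p `` {x}) = infinity_rel p `` {x}"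
proof -
  have sub: "\<phi> h \<circ> z \<in> infinity_rel p `` {x}" if h: "h \<in> carrier G" and z: "z \<in> infinity_rel p `` {x}" for h z
  proof -
    have "(\<phi> h \<circ> x, \<phi> h \<circ> z) \<in> infinity_rel p"
      using z by (intro infinity_rel_isometry[OF isometry[OF h]]) auto
    moreover have "(x, \<phi> h \<circ> x) \<in> infinity_rel p"
      using G h by (auto simp: end_stabilizer_def)
    ultimately show ?thesis by (auto intro: ends_trans)
  qed
  have "z \<in> (\<lambda>x. \<phi> g \<circ> x) ` (infinity_rel p `` {x})" if z: "z \<in> infinity_rel p `` {x}" for z
  proof (rule image_eqI)
    show "z = \<phi> g \<circ> (\<phi> (inv g) \<circ> z)" using g by (auto simp: act_inv')
    show "\<phi> (inv g) \<circ> z \<in> infinity_rel p `` {x}" using sub[of "inv g"] g z by simp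
  qed
  then show ?thesis using sub[OF g] unfolding boundary_map_def by blast
qed

end


section \<open>Elements of V with small support\<close>

definition cylinder :: "bool list \<Rightarrow> bool stream set" where
  "cylinder u = range (\<lambda>y. u @- y)"

definition rigid_stabilizer :: "bool stream set \<Rightarrow> (bool stream \<Rightarrow> bool stream) set" where
  "rigid_stabilizer S = {g \<in> carrier thompson_V. \<forall>x. x \<notin> S \<longrightarrow> g x = x}"

lemma thompson_V_simps [simp]:
  "f \<otimes>\<^bsub>thompson_V\<^esub> g = f \<circ> g" "\<one>\<^bsub>thompson_V\<^esub> = id"
  by (simp_all add: thompson_V_def)

lemma thompson_V_comp:
  "f \<in> carrier thompson_V \<Longrightarrow> g \<in> carrier thompson_V \<Longrightarrow> f \<circ> g \<in> carrier thompson_V"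
  using monoid.m_closed[OF group.is_monoid[OF group_thompson_V]] by simp

lemma thompson_V_bij: "f \<in> carrier thompson_V \<Longrightarrow> bij f"
  by (simp add: thompson_V_iff)

lemma thompson_V_inv:
  assumes "f \<in> carrier thompson_V"
  shows "f ((inv\<^bsub>thompson_V\<^esub> f) x) = x" "(inv\<^bsub>thompson_V\<^esub> f) (f x) = x"
  using group.r_inv[OF group_thompson_V assms] group.l_inv[OF group_thompson_V assms]
  by (simp_all add: fun_eq_iff)

lemma rigid_stabilizer_subset: "rigid_stabilizer S \<subseteq> carrier thompson_V"
  by (auto simp: rigid_stabilizer_def)

lemma rigid_stabilizer_inv:
  assumes "g \<in> rigid_stabilizer S"
  shows "(inv\<^bsub>thompson_V\<^esub> g) \<in> rigid_stabilizer S"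
  using assms group.inv_closed[OF group_thompson_V] thompson_V_inv[of g]
  unfolding rigid_stabilizer_def by (auto, metis)

lemma rigid_stabilizer_image:
  assumes "g \<in> rigid_stabilizer S" "x \<in> S"
  shows "g x \<in> S"
  using assms thompson_V_bij unfolding rigid_stabilizer_def
  by (metis (mono_tags, lifting) bij_is_inj injD mem_Collect_eq)

lemma disjoint_supports_commute:
  assumes "S \<inter> T = {}" "g \<in> rigid_stabilizer S" "h \<in> rigid_stabilizer T"
  shows "g \<circ> h = h \<circ> g"
proof
  fix x
  have "x \<notin> S \<or> x \<notin> T" using assms(1) by blast
  then show "(g \<circ> h) x = (h \<circ> g) x"
    using assms rigid_stabilizer_image[OF assms(2)] rigid_stabilizer_image[OF assms(3)]
    by (cases "x \<in> S"; cases "x \<in> T") (auto simp: rigid_stabilizer_def disjoint_iff)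
qed

lemma rigid_stabilizer_conjugate:
  assumes g: "g \<in> carrier thompson_V" "g ` S \<subseteq> T" and h: "h \<in> rigid_stabilizer S"
  shows "g \<circ> h \<circ> (inv\<^bsub>thompson_V\<^esub> g) \<in> rigid_stabilizer T"
proof -
  have "g (h ((inv\<^bsub>thompson_V\<^esub> g) x)) = x" if "x \<notin> T" for x
  proof -
    have "(inv\<^bsub>thompson_V\<^esub> g) x \<notin> S"
      using that g thompson_V_inv(1)[OF g(1), of x] by (metis image_subset_iff)
    then show ?thesis using h thompson_V_inv(1)[OF g(1)] by (simp add: rigid_stabilizer_def)
  qed
  moreover have "g \<circ> h \<circ> (inv\<^bsub>thompson_V\<^esub> g) \<in> carrier thompson_V"
    using g h group.inv_closed[OF group_thompson_V] rigid_stabilizer_subset[of S]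
    by (intro thompson_V_comp) auto
  ultimately show ?thesis by (simp add: rigid_stabilizer_def)
qed

lemma shift_mem_cylinder [simp]: "u @- y \<in> cylinder u"
  by (simp add: cylinder_def)

lemma cylinder_iff: "x \<in> cylinder u \<longleftrightarrow> stake (length u) x = u"
proof
  assume "stake (length u) x = u"
  then have "x = u @- sdrop (length u) x" by (metis stake_sdrop)
  then show "x \<in> cylinder u" unfolding cylinder_def by blast
qed (auto simp: cylinder_def stake_shift)

lemma cylinder_mono: "prefix u v \<Longrightarrow> cylinder v \<subseteq> cylinder u"
  by (auto simp: cylinder_def prefix_def)

lemma disjoint_cylinders:
  "u \<parallel> v \<Longrightarrow> cylinder u \<inter> cylinder v = {}"
  using shift_eq_prefix unfolding cylinder_def parallel_def by (metis (no_types, lifting) disjoint_iff imageE nle_le)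

definition swap :: "bool list \<Rightarrow> bool list \<Rightarrow> bool stream \<Rightarrow> bool stream" where
  "swap u v x = (if x \<in> cylinder u then v @- sdrop (length u) x
                 else if x \<in> cylinder v then u @- sdrop (length v) x else x)"

lemma swap_left [simp]: "swap u v (u @- x) = v @- x"
  by (simp add: swap_def sdrop_shift)

lemma swap_right: "u \<parallel> v \<Longrightarrow> swap u v (v @- x) = u @- x"
  using disjoint_cylinders[of u v] shift_mem_cylinder[of v x]
  by (auto simp: swap_def sdrop_shift simp del: shift_mem_cylinder)

lemma swap_swap:
  assumes "u \<parallel> v"
  shows "swap u v (swap u v x) = x"
proof -
  consider y where "x = u @- y" | y where "x = v @- y" | "x \<notin> cylinder u" "x \<notin> cylinder v"
    by (auto simp: cylinder_def)
  then show ?thesis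
    by cases (simp_all add: swap_right[OF assms], simp add: swap_def)
qed

lemma swap_in_thompson_V:
  assumes uv: "u \<parallel> v"
  shows "swap u v \<in> carrier thompson_V"
  unfolding thompson_V_iff
proof (intro conjI exI[of _ "length u + length v"] allI impI)
  show "bij (swap u v)"
    by (rule involuntory_imp_bij) (rule swap_swap[OF uv])
  fix w :: "bool list" assume w: "length w = length u + length v"
  consider w' where "w = u @ w'" | w' where "w = v @ w'" | "\<not> prefix u w" "\<not> prefix v w"
    by (auto simp: prefix_def)
  then show "\<exists>w'. \<forall>x. swap u v (w @- x) = w' @- x"
  proof cases
    case (1 w')
    then have "\<forall>x. swap u v (w @- x) = (v @ w') @- x" by simp
    then show ?thesis by blast
  next
    case (2 w')
    then have "\<forall>x. swap u v (w @- x) = (u @ w') @- x" by (simp add: swap_right[OF uv])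
    then show ?thesis by blast
  next
    case 3
    have "w @- x \<notin> cylinder u \<and> w @- x \<notin> cylinder v" for x
      using 3 w shift_eq_prefix[of u _ w x] shift_eq_prefix[of v _ w x] by (auto simp: cylinder_def)
    then show ?thesis by (auto simp: swap_def)
  qed
qed

lemma swap_in_rigid_stabilizer:
  assumes "u \<parallel> v" "cylinder u \<inter> cylinder c = {}" "cylinder v \<inter> cylinder c = {}"
  shows "swap u v \<in> rigid_stabilizer (- cylinder c)"
  using assms swap_in_thompson_V[OF assms(1)] by (auto simp: rigid_stabilizer_def swap_def)

lemma swap_image: "u \<parallel> v \<Longrightarrow> swap u v ` cylinder u = cylinder v"
  by (auto simp: cylinder_def image_iff)

text \<open>Comparable words start with the same letter, so both are incomparable with the other
  one-letter word, and two swaps through it do the job.\<close>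

lemma thompson_V_transitive_on_cylinders:
  assumes "u \<noteq> []" "v \<noteq> []"
  obtains g where "g \<in> carrier thompson_V" "g ` cylinder u = cylinder v"
proof (cases "u \<parallel> v")
  case True
  then show ?thesis using that swap_in_thompson_V swap_image by blast
next
  case False
  define c where "c = [\<not> hd u]"
  have "hd u = hd v" using False assms by (cases u; cases v) auto
  then have "u \<parallel> c" "c \<parallel> v"
    using assms by (cases u; cases v; auto simp: c_def parallel_def)+
  then have "swap c v \<circ> swap u c \<in> carrier thompson_V"
    "(swap c v \<circ> swap u c) ` cylinder u = cylinder v"
    by (simp_all only: thompson_V_comp swap_in_thompson_V image_comp[symmetric] swap_image)
  then show ?thesis using that by blast
qed

text \<open>Long enough prefixes of \<open>x\<close> and \<open>v x\<close> record the position in which these sequences differ,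
  and \<open>v\<close> replaces the one by the other.\<close>

lemma thompson_V_moves_small_cylinder:
  assumes v: "v \<in> carrier thompson_V" and x: "v x \<noteq> x"
  obtains u u' where "u \<parallel> u'" "N \<le> length u" "N \<le> length u'" "\<And>y. v (u @- y) = u' @- y"
proof -
  obtain n where n: "\<And>w. length w = n \<Longrightarrow> \<exists>w'. \<forall>y. v (w @- y) = w' @- y"
    using v unfolding thompson_V_iff by blast
  then obtain w' where w': "\<And>y. v (stake n x @- y) = w' @- y"
    using length_stake by blast
  obtain m where m: "v x !! m \<noteq> x !! m"
    using x smap_alt[of id x "v x"] by (auto simp: stream.map_id)
  define k where "k = Suc m + N"
  define u where "u = stake n x @ stake k (sdrop n x)"
  define u' where "u' = w' @ stake k (sdrop n x)"
  have vu: "v (u @- y) = u' @- y" for y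
    by (simp only: u_def u'_def shift_append w')
  have x_eq: "x = u @- sdrop k (sdrop n x)"
    by (simp only: u_def shift_append stake_sdrop)
  have "u \<parallel> u'"
  proof (rule parallelI)
    have l: "m < length u" "m < length u'" by (auto simp: u_def u'_def k_def)
    have "x !! m = u ! m" using x_eq l by (metis shift_snth_less)
    moreover have "v x !! m = u' ! m" using x_eq vu l by (metis shift_snth_less)
    ultimately have ne: "u ! m \<noteq> u' ! m" using m by simp
    show "\<not> prefix u u'" "\<not> prefix u' u"
      using ne l by (auto simp: prefix_def nth_append)
  qed
  then show ?thesis using that[of u u'] vu by (simp add: u_def u'_def k_def)
qed

lemma parallel_two_letter_word:
  assumes "2 \<le> length u" "length a = 2" "a \<noteq> take 2 u"
  shows "u \<parallel> a"
proof -
  have "take 2 u \<parallel> a"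
    using assms by (intro not_equal_is_parallel) auto
  then show ?thesis
    by (rule parallel_appendI[of _ _ _ "drop 2 u" _ "[]"]) simp_all
qed

lemmas disjoint_two_letter_cylinder = disjoint_cylinders[OF parallel_two_letter_word]

lemma two_letter_word_avoiding:
  fixes a b c :: "bool list"
  obtains d where "length d = 2" "d \<noteq> a" "d \<noteq> b" "d \<noteq> c"
proof -
  have "card {d :: bool list. length d = 2} = 4"
    using card_lists_length_eq[of "UNIV :: bool set" 2] by simp
  moreover have "card {a, b, c} < 4"
    using card_length[of "[a, b, c]"] by simp
  ultimately have "\<not> {d :: bool list. length d = 2} \<subseteq> {a, b, c}"
    using card_mono[of "{a, b, c}" "{d :: bool list. length d = 2}"] by fastforce
  then show ?thesis using that by blast
qed

definition fixing_two_letter_cylinder :: "(bool stream \<Rightarrow> bool stream) set" where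
  "fixing_two_letter_cylinder = (\<Union>a\<in>{a. length a = 2}. rigid_stabilizer (- cylinder a))"

text \<open>An element \<open>v\<close> that maps the cylinder of \<open>u\<close> onto a disjoint cylinder of \<open>u'\<close> becomes the
  identity on the former after composition with the swap of the two. That cylinder
  may be tiny; another swap, which fixes some two-letter cylinder, carries it onto a two-letter
  cylinder. The number of factors does not depend on \<open>v\<close>.\<close>

lemma thompson_V_boundedly_generated:
  assumes v: "v \<in> carrier thompson_V"
  obtains g1 g2 g3 g4 where "g1 \<in> fixing_two_letter_cylinder" "g2 \<in> fixing_two_letter_cylinder"
    "g3 \<in> fixing_two_letter_cylinder" "g4 \<in> fixing_two_letter_cylinder"
    "v = g1 \<circ> (g2 \<circ> (g3 \<circ> g4))"
proof (cases "\<exists>x. v x \<noteq> x")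
  case False
  then have "v \<in> rigid_stabilizer (- cylinder [True, True])" "id \<in> rigid_stabilizer (- cylinder [True, True])"
    using v monoid.one_closed[OF group.is_monoid[OF group_thompson_V]]
    by (auto simp: rigid_stabilizer_def)
  then have "v \<in> fixing_two_letter_cylinder" "id \<in> fixing_two_letter_cylinder"
    unfolding fixing_two_letter_cylinder_def by force+
  then show ?thesis using that[of v id id id] by simp
next
  case True
  then obtain u u' where u: "u \<parallel> u'" "2 \<le> length u" "2 \<le> length u'"
    and vu: "\<And>y. v (u @- y) = u' @- y"
    using thompson_V_moves_small_cylinder[OF v, of _ 2] by metis
  define s where "s = swap u u'"
  obtain e where e: "length e = 2" "e \<noteq> take 2 u" "e \<noteq> take 2 u'"
    using two_letter_word_avoiding by blast
  have s: "s \<in> rigid_stabilizer (- cylinder e)"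
    unfolding s_def using u e
    by (intro swap_in_rigid_stabilizer disjoint_two_letter_cylinder) auto
  obtain b where b: "length b = 2" "b \<noteq> take 2 u"
    using two_letter_word_avoiding by blast
  obtain c where c: "length c = 2" "c \<noteq> take 2 u" "c \<noteq> b"
    using two_letter_word_avoiding by blast
  define t where "t = swap u b"
  have ub: "u \<parallel> b"
    using u(2) b by (rule parallel_two_letter_word)
  have t: "t \<in> rigid_stabilizer (- cylinder c)"
    unfolding t_def using u b c ub
    by (intro swap_in_rigid_stabilizer disjoint_two_letter_cylinder) auto
  define w where "w = t \<circ> (s \<circ> v \<circ> t)"
  have "w \<in> carrier thompson_V"
    unfolding w_def using s t v rigid_stabilizer_subset by (intro thompson_V_comp) auto
  moreover have "w x = x" if "x \<in> cylinder b" for x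
  proof -
    obtain y where "x = b @- y" using \<open>x \<in> cylinder b\<close> by (auto simp: cylinder_def)
    then show ?thesis
      by (simp add: w_def t_def s_def swap_right[OF ub] swap_right[OF u(1)] vu)
  qed
  ultimately have w: "w \<in> rigid_stabilizer (- cylinder b)"
    by (auto simp: rigid_stabilizer_def)
  have "v = s \<circ> (t \<circ> (w \<circ> t))"
    by (auto simp: w_def s_def t_def swap_swap[OF ub] swap_swap[OF u(1)])
  moreover have "s \<in> fixing_two_letter_cylinder" "t \<in> fixing_two_letter_cylinder"
    "w \<in> fixing_two_letter_cylinder"
    using s t w e(1) b(1) c(1) unfolding fixing_two_letter_cylinder_def by blast+
  ultimately show ?thesis using that by blast
qed


section \<open>Actions of V\<close>

locale hyperbolic_V_action = hyperbolic_action thompson_V \<phi> p \<delta>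
  for \<phi> :: "(bool stream \<Rightarrow> bool stream) \<Rightarrow> 'x::metric_space \<Rightarrow> 'x" and p \<delta>
begin

lemma unbounded_rigid_stabilizer_image:
  assumes "unbounded_orbit (rigid_stabilizer S)" "g \<in> carrier thompson_V" "g ` S \<subseteq> T"
  shows "unbounded_orbit (rigid_stabilizer T)"
proof (rule unbounded_orbit_conjugate[OF assms(1) rigid_stabilizer_subset assms(2)])
  show "g \<otimes>\<^bsub>thompson_V\<^esub> s \<otimes>\<^bsub>thompson_V\<^esub> (inv\<^bsub>thompson_V\<^esub> g) \<in> rigid_stabilizer T"
    if "s \<in> rigid_stabilizer S" for s
    using rigid_stabilizer_conjugate[OF assms(2,3) that] by simp
qed (rule rigid_stabilizer_subset)

text \<open>If all the factors moved the basepoint by at most \<open>M\<close>, then four of them would move it by at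
  most \<open>4 M\<close>.\<close>

lemma unbounded_two_letter_factor:
  assumes unb: "unbounded_orbit (carrier thompson_V)"
  shows "\<exists>a. length a = 2 \<and> unbounded_orbit (rigid_stabilizer (- cylinder a))"
proof (rule ccontr)
  assume "\<not> ?thesis"
  then have "\<forall>a\<in>{a. length a = 2}. \<exists>K. \<forall>g\<in>rigid_stabilizer (- cylinder a). displacement g < K"
    unfolding unbounded_orbit_def by (meson mem_Collect_eq not_le)
  then obtain K where K: "\<And>a g. length a = 2 \<Longrightarrow> g \<in> rigid_stabilizer (- cylinder a) \<Longrightarrow> displacement g < K a"
    by (metis (mono_tags, lifting) mem_Collect_eq)
  define M where "M = Max (K ` {a. length a = 2})"
  have fin: "finite {a :: bool list. length a = 2}"
    using finite_lists_length_eq[of "UNIV :: bool set" 2] by simp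
  have M: "displacement g \<le> M" "g \<in> carrier thompson_V" if g: "g \<in> fixing_two_letter_cylinder" for g
  proof -
    obtain a where a: "length a = 2" "g \<in> rigid_stabilizer (- cylinder a)"
      using g unfolding fixing_two_letter_cylinder_def by blast
    then have "K a \<le> M" unfolding M_def using fin by (intro Max_ge) auto
    then show "displacement g \<le> M" using K a by fastforce
    show "g \<in> carrier thompson_V" using a rigid_stabilizer_subset by blast
  qed
  have "displacement v \<le> 4 * M" if v_in: "v \<in> carrier thompson_V" for v
  proof -
    obtain g1 g2 g3 g4 where g: "g1 \<in> fixing_two_letter_cylinder" "g2 \<in> fixing_two_letter_cylinder"
      "g3 \<in> fixing_two_letter_cylinder" "g4 \<in> fixing_two_letter_cylinder"
      and v: "v = g1 \<circ> (g2 \<circ> (g3 \<circ> g4))"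
      using thompson_V_boundedly_generated[OF v_in] by metis
    show ?thesis
      using displacement_mult[of g1 "g2 \<circ> (g3 \<circ> g4)"] displacement_mult[of g2 "g3 \<circ> g4"]
        displacement_mult[of g3 g4] M[OF g(1)] M[OF g(2)] M[OF g(3)] M[OF g(4)]
      by (simp add: v thompson_V_comp)
  qed
  moreover obtain v where "v \<in> carrier thompson_V" "4 * M + 1 \<le> displacement v"
    using unb unfolding unbounded_orbit_def by blast
  ultimately show False by fastforce
qed

text \<open>Complements of cylinders are exchanged for cylinders by means of the two halves of the Cantor
  set, which are cylinders and complements of each other.\<close>

lemma unbounded_cylinder:
  assumes unb: "unbounded_orbit (carrier thompson_V)" and b: "b \<noteq> []"
  shows "unbounded_orbit (rigid_stabilizer (cylinder b))"
proof -
  obtain a where a: "length a = 2" "unbounded_orbit (rigid_stabilizer (- cylinder a))"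
    using unbounded_two_letter_factor[OF unb] by blast
  obtain g where g: "g \<in> carrier thompson_V" "g ` cylinder a = cylinder [True]"
    using thompson_V_transitive_on_cylinders[of a "[True]"] a(1) by (metis length_0_conv not_Cons_self zero_neq_numeral)
  have "- cylinder [True] = cylinder [False]"
    by (auto simp: cylinder_iff)
  then have "g ` (- cylinder a) = cylinder [False]"
    using g bij_image_Compl_eq[OF thompson_V_bij[OF g(1)], of "cylinder a"] by simp
  then have F: "unbounded_orbit (rigid_stabilizer (cylinder [False]))"
    using unbounded_rigid_stabilizer_image[OF a(2) g(1)] by simp
  obtain h where "h \<in> carrier thompson_V" "h ` cylinder [False] = cylinder b"
    using thompson_V_transitive_on_cylinders[of "[False]" b] b by blast
  then show ?thesis using unbounded_rigid_stabilizer_image[OF F] by simp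
qed

lemma commuting_rigid_stabilizers:
  "S \<inter> T = {} \<Longrightarrow> commuting (rigid_stabilizer S) (rigid_stabilizer T)"
  unfolding commuting_def thompson_V_simps using disjoint_supports_commute by blast

text \<open>The limits of the groups of elements supported in the four two-letter cylinders coincide;
  one of them is fixed by every element that fixes a two-letter cylinder pointwise.\<close>

lemma fixed_end:
  assumes unb: "unbounded_orbit (carrier thompson_V)"
  obtains x where "converges_at_infinity p x" "carrier thompson_V \<subseteq> end_stabilizer x"
proof -
  let ?a = "[False, False]"
  have disj: "cylinder ?a \<inter> cylinder b = {}" if "length b = 2" "b \<noteq> ?a" for b
    using disjoint_two_letter_cylinder[of ?a b] that by simp
  obtain x where x: "orbit_limit (rigid_stabilizer (cylinder ?a)) x"
    using commuting_orbit_limit[of "rigid_stabilizer (cylinder ?a)" "rigid_stabilizer (cylinder [True, True])"]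
      unbounded_cylinder[OF unb] commuting_rigid_stabilizers[OF disj, of "[True, True]"] rigid_stabilizer_subset
    by auto
  have fix_end: "rigid_stabilizer (- cylinder b) \<subseteq> end_stabilizer x" if b: "length b = 2" for b
  proof -
    have comm: "commuting (rigid_stabilizer (cylinder b)) (rigid_stabilizer (- cylinder b))"
      by (rule commuting_rigid_stabilizers) simp
    show ?thesis
    proof (cases "b = ?a")
      case True
      show ?thesis
        using commuting_fixes_limit[OF rigid_stabilizer_subset x rigid_stabilizer_subset] comm True
        by blast
    next
      case False
      have "b \<noteq> []" using b by auto
      from commuting_limit_transfer[OF rigid_stabilizer_subset x rigid_stabilizer_subset
          unbounded_cylinder[OF unb this]
          rigid_stabilizer_inv commuting_rigid_stabilizers[OF disj[OF b False]]]
      obtain y where y: "orbit_limit (rigid_stabilizer (cylinder b)) y" "(x, y) \<in> infinity_rel p"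
        by blast
      have "rigid_stabilizer (- cylinder b) \<subseteq> end_stabilizer y"
        by (rule commuting_fixes_limit[OF rigid_stabilizer_subset y(1) rigid_stabilizer_subset comm])
      also have "\<dots> \<subseteq> end_stabilizer x"
        by (rule end_stabilizer_cong[OF ends_sym[OF y(2)]])
      finally show ?thesis .
    qed
  qed
  then have gen: "g \<in> end_stabilizer x" if "g \<in> fixing_two_letter_cylinder" for g
    using that unfolding fixing_two_letter_cylinder_def by blast
  have "v \<in> end_stabilizer x" if v_in: "v \<in> carrier thompson_V" for v
  proof (rule thompson_V_boundedly_generated[OF v_in])
    fix g1 g2 g3 g4
    assume g: "g1 \<in> fixing_two_letter_cylinder" "g2 \<in> fixing_two_letter_cylinder"
      "g3 \<in> fixing_two_letter_cylinder" "g4 \<in> fixing_two_letter_cylinder"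
      and v: "v = g1 \<circ> (g2 \<circ> (g3 \<circ> g4))"
    have "g1 \<otimes>\<^bsub>thompson_V\<^esub> (g2 \<otimes>\<^bsub>thompson_V\<^esub> (g3 \<otimes>\<^bsub>thompson_V\<^esub> g4)) \<in> end_stabilizer x"
      by (intro end_stabilizer_mult gen g)
    then show ?thesis by (simp add: v)
  qed
  then have "carrier thompson_V \<subseteq> end_stabilizer x" by blast
  moreover have "converges_at_infinity p x"
    using x by (simp add: orbit_limit_def)
  ultimately show ?thesis by (rule that[rotated])
qed

end

theorem theorem1p2:
  fixes \<phi> :: "(bool stream \<Rightarrow> bool stream) \<Rightarrow> 'a::metric_space \<Rightarrow> 'a" and p :: 'a
  assumes "gromov_hyperbolic TYPE('a)"
    and "group_action thompson_V UNIV \<phi>"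
    and "\<And>g x y. g \<in> carrier thompson_V \<Longrightarrow> dist (\<phi> g x) (\<phi> g y) = dist x y"
  shows "(\<exists>\<xi>\<in>gromov_boundary p. \<forall>g\<in>carrier thompson_V. boundary_map (\<phi> g) \<xi> = \<xi>) \<or>
         (\<forall>x. bounded (orbit thompson_V \<phi> x))"
proof (rule disjCI)
  assume "\<not> (\<forall>x. bounded (orbit thompson_V \<phi> x))"
  \<comment> \<open>The unbounded orbit provides the basepoint; the boundary does not depend on it.\<close>
  then obtain q where q: "\<not> bounded (orbit thompson_V \<phi> q)" by blast
  obtain \<delta> where \<delta>: "\<delta> \<ge> 0" "delta_hyperbolic \<delta> TYPE('a)"
    using assms(1) unfolding gromov_hyperbolic_def by blast
  interpret hyperbolic_V_action \<phi> q \<delta>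
  proof (intro hyperbolic_V_action.intro hyperbolic_action.intro hyperbolic_action_axioms.intro)
    show "group_action thompson_V UNIV \<phi>" by fact
    show "dist (\<phi> g x) (\<phi> g y) = dist x y" if "g \<in> carrier thompson_V" for g x y
      by (rule assms(3)[OF that])
    show "min (gromov_product w x y) (gromov_product w y z) - \<delta> \<le> gromov_product w x z" for w x y z :: 'a
      using \<delta>(2) unfolding delta_hyperbolic_def by blast
    show "0 \<le> \<delta>" by fact
  qed
  have "unbounded_orbit (carrier thompson_V)"
    unfolding unbounded_orbit_def
  proof
    fix K
    obtain y where "y \<in> orbit thompson_V \<phi> q" "\<not> dist q y \<le> K"
      using q unfolding bounded_any_center[of _ q] by blast
    then obtain g where "g \<in> carrier thompson_V" "\<not> displacement g \<le> K"
      unfolding orbit_def by blast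
    then show "\<exists>g\<in>carrier thompson_V. K \<le> displacement g"
      by (intro bexI[of _ g]) simp_all
  qed
  then obtain x where x: "converges_at_infinity q x" "carrier thompson_V \<subseteq> end_stabilizer x"
    using fixed_end by blast
  have "infinity_rel q `` {x} \<in> gromov_boundary q"
    unfolding gromov_boundary_def using x(1) by (intro quotientI) simp
  then have "infinity_rel q `` {x} \<in> gromov_boundary p"
    by (simp only: gromov_boundary_basepoint[of p q])
  then show "\<exists>\<xi>\<in>gromov_boundary p. \<forall>g\<in>carrier thompson_V. boundary_map (\<phi> g) \<xi> = \<xi>"
    using boundary_map_fixes_end[OF x(2)] by blast
qed

end
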